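(* Let $K$ be a locally connected and locally compact normal (Hausdorff) space. Suppose that $\mathbb{Y}$ is a proper closed subspace of the real Banach space $C_0(K)=C_0(K,\mathbb{R})$. Then the following are equivalent: (i) $\mathbb{Y}$ is strongly anti-coproximinal in $C_0(K)$. (ii) $\mathbb{Y}$ is anti-coproximinal in $C_0(K)$. (iii) For each nonempty open subset $U$ of $K$, there exists an $f\in\mathbb{Y}$ such that $M_f\subset U$.
   Context: $C_0(K,\mathbb{R})$ is the real Banach space of bounded continuous functions $f:K\to\mathbb{R}$ such that for every $\epsilon>0$ there is a compact set $\Gamma\subset K$ with $|f(k)|<\epsilon$ for all $k\in K\setminus\Gamma$, with the supremum norm. For $f\in C_0(K,\mathbb{R})$, $M_f=\{k\in K: |f(k)|=\|f\|\}$. Let $\mathbb{X}$ be a Banach space and $\mathbb{Y}$ a subspace. For $x\in\mathbb{X}$, $y_0\in\mathbb{Y}$ is a best coapproximation to $x$ out of $\mathbb{Y}$ if $\|y_0-y\|\le\|x-y\|$ for all $y\in\mathbb{Y}$. $\mathbb{Y}$ is anti-coproximinal in $\mathbb{X}$ if for every $x\in\mathbb{X}\setminus\mathbb{Y}$ there is no best coapproximation to $x$ out of $\mathbb{Y}$. For $\epsilon\in[0,1)$ and $x,y\in\mathbb{X}$, write $x\perp_B^{\epsilon} y$ if $\|x+\lambda y\|\ge\|x\|-\epsilon\|\lambda y\|$ for every scalar $\lambda$; $y_0\in\mathbb{Y}$ is an $\epsilon$-best coapproximation to $x$ out of $\mathbb{Y}$ if $y\perp_B^{\epsilon}(x-y_0)$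 for all $y\in\mathbb{Y}$. $\mathbb{Y}$ is strongly anti-coproximinal in $\mathbb{X}$ if for every $x\in\mathbb{X}\setminus\mathbb{Y}$ and every $\epsilon\in[0,1)$ there is no $\epsilon$-best coapproximation to $x$ out of $\mathbb{Y}$.
   Formalization: K is assumed to have at least two points: for one-point K the claim fails, since the only proper subspace Y={0} satisfies (iii) with f=0 (M_0=K), while 0 is a best coapproximation to every x, so (i) and (ii) fail. *)

theory Defs
  imports "HOL-Analysis.Analysis"
begin

text \<open>In the definitions below the ambient space is a set \<open>X\<close> of vectors carrying the
  norm of the type \<open>'a\<close>; \<open>Y\<close> is meant to be a linear subspace contained in \<open>X\<close>.\<close>

definition best_coapproximation :: "'a::real_normed_vector set \<Rightarrow> 'a \<Rightarrow> 'a \<Rightarrow> bool" where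
  "best_coapproximation Y x y0 \<longleftrightarrow> y0 \<in> Y \<and> (\<forall>y\<in>Y. norm (y0 - y) \<le> norm (x - y))"

definition anti_coproximinal :: "'a::real_normed_vector set \<Rightarrow> 'a set \<Rightarrow> bool" where
  "anti_coproximinal X Y \<longleftrightarrow> (\<forall>x\<in>X - Y. \<not> (\<exists>y0. best_coapproximation Y x y0))"

definition eps_BJ_orthogonal :: "real \<Rightarrow> 'a::real_normed_vector \<Rightarrow> 'a \<Rightarrow> bool" where
  "eps_BJ_orthogonal \<epsilon> x y \<longleftrightarrow>
     (\<forall>c::real. norm (x + c *\<^sub>R y) \<ge> norm x - \<epsilon> * norm (c *\<^sub>R y))"

definition eps_best_coapproximation ::
    "real \<Rightarrow> 'a::real_normed_vector set \<Rightarrow> 'a \<Rightarrow> 'a \<Rightarrow> bool" where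
  "eps_best_coapproximation \<epsilon> Y x y0 \<longleftrightarrow>
     y0 \<in> Y \<and> (\<forall>y\<in>Y. eps_BJ_orthogonal \<epsilon> y (x - y0))"

definition strongly_anti_coproximinal :: "'a::real_normed_vector set \<Rightarrow> 'a set \<Rightarrow> bool" where
  "strongly_anti_coproximinal X Y \<longleftrightarrow>
     (\<forall>x\<in>X - Y. \<forall>\<epsilon>\<in>{0..<1}. \<not> (\<exists>y0. eps_best_coapproximation \<epsilon> Y x y0))"

text \<open>The library type of bounded continuous functions already carries the supremum norm,
  so \<open>C\<^sub>0(K)\<close> is taken as a subset of it, where \<open>K\<close> is the whole type \<open>'k\<close>.\<close>

definition C0 :: "('k::topological_space \<Rightarrow>\<^sub>C real) set" where
  "C0 = {f. \<forall>\<epsilon>>0. \<exists>\<Gamma>. compact \<Gamma> \<and> (\<forall>k. k \<notin> \<Gamma> \<longrightarrow> \<bar>apply_bcontfun f k\<bar> < \<epsilon>)}"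

definition norm_attainment_set :: "('k::topological_space \<Rightarrow>\<^sub>C real) \<Rightarrow> 'k set" where
  "norm_attainment_set f = {k. \<bar>apply_bcontfun f k\<bar> = norm f}"

end

theory Submission
  imports Defs
begin

text \<open>Two elementary constructions carry the equivalences.

  First, suppose that \<open>Y\<close> contains functions peaking inside every nonempty open set. Such a
  function may peak with both signs, but combining two of them gives one that peaks with only one
  sign: if \<open>f\<close> is positive on an open set \<open>V\<close>, and \<open>h\<close> attains its norm only inside \<open>V\<close>, and with
  the value \<open>\<parallel>h\<parallel>\<close> at some point, then for large \<open>N\<close> the function \<open>N h + f\<close> attains its norm only
  inside \<open>V\<close>, and only with positive sign, because the positive summand \<open>f\<close> lowers the absolute
  value wherever \<open>N h\<close> is close to \<open>-N\<parallel>h\<parallel>\<close>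
  (lemma \<open>ex_one_signed_peak\<close>). Now let \<open>y\<^sub>0\<close> be an
  \<open>\<epsilon>\<close>-best coapproximation to \<open>x \<notin> Y\<close> and put \<open>g = x - y\<^sub>0\<close>. For \<open>\<epsilon> < e < 1\<close> take the peak
  inside the open set where \<open>g\<close>, up to a sign, exceeds \<open>e\<parallel>g\<parallel>\<close>. Subtracting a small multiple
  \<open>\<lambda>g\<close> (with that sign) lowers the norm of the peaking function by at least \<open>\<lambda>e\<parallel>g\<parallel>\<close>, which
  contradicts \<open>\<epsilon>\<close>-orthogonality (lemma \<open>one_signed_peak_not_orthogonal\<close>).

  Conversely, suppose that no element of \<open>Y\<close> attains its norm only inside the nonempty open set
  \<open>U\<close>, and let \<open>x \<noteq> 0\<close> be a function in \<open>C\<^sub>0(K)\<close> vanishing outside \<open>U\<close>. Then \<open>x \<notin> Y\<close>, and every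
  \<open>y \<in> Y\<close> attains its norm at a point where \<open>x\<close> vanishes, so that \<open>\<parallel>y\<parallel> \<le> \<parallel>x - y\<parallel>\<close>. Hence \<open>0\<close>
  is a best coapproximation to \<open>x\<close>.\<close>

section \<open>Norm attainment in \<open>C\<^sub>0(K)\<close>\<close>

lemma abs_apply_bcontfun_le_norm: "\<bar>apply_bcontfun f k\<bar> \<le> norm f"
  for f :: "'k::topological_space \<Rightarrow>\<^sub>C real"
  using norm_bounded[of f k] by simp

text \<open>Outside a compact set \<open>\<bar>f\<bar>\<close> stays below \<open>\<parallel>f\<parallel>/2\<close>, and on the compact part of \<open>S\<close> it attains
  its maximum.\<close>

lemma C0_bounded_away_from_norm:
  fixes f :: "'k::t2_space \<Rightarrow>\<^sub>C real"
  assumes f: "f \<in> C0" "f \<noteq> 0" and S: "closed S" "S \<inter> norm_attainment_set f = {}"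
  obtains d where "d > 0" "d \<le> norm f" "\<And>k. k \<in> S \<Longrightarrow> \<bar>apply_bcontfun f k\<bar> \<le> norm f - d"
proof -
  have pos: "norm f > 0" using f by simp
  have "\<forall>r>0. \<exists>G. compact G \<and> (\<forall>k. k \<notin> G \<longrightarrow> \<bar>apply_bcontfun f k\<bar> < r)"
    using f(1) by (simp add: C0_def)
  then obtain G where G: "compact G" "\<And>k. k \<notin> G \<Longrightarrow> \<bar>apply_bcontfun f k\<bar> < norm f / 2"
    using half_gt_zero[OF pos] by blast
  show thesis
  proof (cases "G \<inter> S = {}")
    case True
    show thesis
    proof (rule that[of "norm f / 2"])
      fix k assume "k \<in> S"
      then have "\<bar>apply_bcontfun f k\<bar> < norm f / 2" using True G(2) by blast
      then show "\<bar>apply_bcontfun f k\<bar> \<le> norm f - norm f / 2" by simp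
    qed (use pos in auto)
  next
    case False
    have "compact (G \<inter> S)" using G(1) S(1) by (rule compact_Int_closed)
    moreover have "continuous_on (G \<inter> S) (\<lambda>k. \<bar>apply_bcontfun f k\<bar>)"
      by (intro continuous_intros continuous_on_apply_bcontfun)
    ultimately obtain m where m: "m \<in> G \<inter> S"
      "\<And>k. k \<in> G \<inter> S \<Longrightarrow> \<bar>apply_bcontfun f k\<bar> \<le> \<bar>apply_bcontfun f m\<bar>"
      using continuous_attains_sup[OF _ False] by blast
    have "\<bar>apply_bcontfun f m\<bar> \<noteq> norm f"
      using m(1) S(2) by (auto simp: norm_attainment_set_def)
    then have lt: "\<bar>apply_bcontfun f m\<bar> < norm f"
      using abs_apply_bcontfun_le_norm[of f m] by linarith
    show thesis
    proof (rule that[of "min (norm f / 2) (norm f - \<bar>apply_bcontfun f m\<bar>)"])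
      fix k assume k: "k \<in> S"
      show "\<bar>apply_bcontfun f k\<bar>
          \<le> norm f - min (norm f / 2) (norm f - \<bar>apply_bcontfun f m\<bar>)"
      proof (cases "k \<in> G")
        case True
        then show ?thesis using m(2)[of k] k by auto
      next
        case False
        then show ?thesis using G(2)[of k] by auto
      qed
    qed (use pos lt in auto)
  qed
qed

lemma C0_norm_attained:
  fixes f :: "'k::t2_space \<Rightarrow>\<^sub>C real"
  assumes f: "f \<in> C0" "f \<noteq> 0"
  obtains p where "p \<in> norm_attainment_set f"
proof (cases "norm_attainment_set f = {}")
  case True
  then obtain d where d: "d > 0" "\<And>k. \<bar>apply_bcontfun f k\<bar> \<le> norm f - d"
    using C0_bounded_away_from_norm[OF f closed_UNIV] by (metis Int_UNIV_left UNIV_I)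
  then have "norm f \<le> norm f - d" by (intro norm_bound) auto
  then show thesis using d(1) by simp
qed (use that in blast)

lemma norm_attainment_set_zero: "norm_attainment_set 0 = UNIV"
  by (simp add: norm_attainment_set_def)

section \<open>Functions peaking with one sign\<close>

lemma ex_positive_peak:
  fixes Y :: "('k::t2_space \<Rightarrow>\<^sub>C real) set"
  assumes Y: "subspace Y" "Y \<subseteq> C0"
    and peak: "\<forall>U. open U \<and> U \<noteq> {} \<longrightarrow> (\<exists>f\<in>Y. norm_attainment_set f \<subseteq> U)"
    and U: "open U" "U \<noteq> {}" "U \<noteq> UNIV"
  obtains f p where "f \<in> Y" "norm_attainment_set f \<subseteq> U" "p \<in> U"
    "apply_bcontfun f p = norm f" "f \<noteq> 0"
proof -
  obtain f where f: "f \<in> Y" "norm_attainment_set f \<subseteq> U" using peak U by blast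
  have nz: "f \<noteq> 0" using f(2) U(3) norm_attainment_set_zero by auto
  then obtain p where p: "p \<in> norm_attainment_set f"
    using C0_norm_attained f(1) Y(2) by blast
  show thesis
  proof (cases "apply_bcontfun f p \<ge> 0")
    case True
    then have "apply_bcontfun f p = norm f" using p by (simp add: norm_attainment_set_def)
    then show thesis using that f nz p by blast
  next
    case False
    then have "apply_bcontfun (- f) p = norm (- f)"
      using p by (simp add: norm_attainment_set_def)
    moreover have "norm_attainment_set (- f) = norm_attainment_set f"
      by (simp add: norm_attainment_set_def)
    moreover have "- f \<in> Y" using f(1) Y(1) by (simp add: subspace_neg)
    ultimately show thesis using that[of "- f" p] f nz p by auto
  qed
qed

lemma ex_one_signed_peak:
  fixes Y :: "('k::t2_space \<Rightarrow>\<^sub>C real) set"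
  assumes Y: "subspace Y" "Y \<subseteq> C0"
    and peak: "\<forall>U. open U \<and> U \<noteq> {} \<longrightarrow> (\<exists>f\<in>Y. norm_attainment_set f \<subseteq> U)"
    and U: "open U" "U \<noteq> {}" "U \<noteq> UNIV"
  obtains F where "F \<in> Y" "F \<noteq> 0" "norm_attainment_set F \<subseteq> U"
    "\<forall>k \<in> norm_attainment_set F. apply_bcontfun F k = norm F"
proof -
  obtain f q where f: "f \<in> Y" "q \<in> U" "apply_bcontfun f q = norm f" "f \<noteq> 0"
    using ex_positive_peak[OF Y peak U] by metis
  define V where "V = U \<inter> {k. apply_bcontfun f k > 0}"
  have "open {k. apply_bcontfun f k > 0}"
    by (intro open_Collect_less continuous_on_const continuous_on_apply_bcontfun)
  then have V: "open V" "V \<noteq> {}" "V \<noteq> UNIV" using U f by (auto simp: V_def)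
  obtain h p where h: "h \<in> Y" "norm_attainment_set h \<subseteq> V" "p \<in> V"
    "apply_bcontfun h p = norm h" "h \<noteq> 0"
    using ex_positive_peak[OF Y peak V] by metis
  have "closed (- V)" "- V \<inter> norm_attainment_set h = {}" using V(1) h(2) by auto
  then obtain d where d: "d > 0" "\<And>k. k \<notin> V \<Longrightarrow> \<bar>apply_bcontfun h k\<bar> \<le> norm h - d"
    using C0_bounded_away_from_norm[of h "- V"] h(1,5) Y(2) by (metis Compl_iff subsetD)
  \<comment> \<open>Any \<open>N\<close> with \<open>N * d > norm f\<close> makes the gap of \<open>N h\<close> off \<open>V\<close> outweigh \<open>f\<close>.\<close>
  define N where "N = (norm f + 1) / d"
  have N: "N > 0" "N * d = norm f + 1"
    using d(1) by (auto simp: N_def add_nonneg_pos)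
  define F where "F = N *\<^sub>R h + f"
  have F: "apply_bcontfun F k = N * apply_bcontfun h k + apply_bcontfun f k" for k
    by (simp add: F_def)
  have "apply_bcontfun F p > N * norm h"
    using h(3,4) by (simp add: F V_def)
  then have nF: "norm F > N * norm h"
    using abs_apply_bcontfun_le_norm[of F p] by linarith
  have "norm F > 0"
    using nF N(1) by (metis less_eq_real_def mult_nonneg_nonneg norm_ge_zero order_le_less_trans)
  have inV: "k \<in> V" if k: "k \<in> norm_attainment_set F" for k
  proof (rule ccontr)
    assume "k \<notin> V"
    have "\<bar>apply_bcontfun F k\<bar> \<le> N * \<bar>apply_bcontfun h k\<bar> + \<bar>apply_bcontfun f k\<bar>"
      unfolding F using N(1) by (metis abs_mult abs_of_pos abs_triangle_ineq)
    also have "\<dots> \<le> N * (norm h - d) + norm f"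
      using d(2)[OF \<open>k \<notin> V\<close>] N(1) by (intro add_mono mult_left_mono abs_apply_bcontfun_le_norm) auto
    also have "\<dots> < N * norm h" using N(2) by (simp add: algebra_simps)
    finally show False using k nF by (simp add: norm_attainment_set_def)
  qed
  have "apply_bcontfun F k = norm F" if k: "k \<in> norm_attainment_set F" for k
  proof -
    have "N * apply_bcontfun h k \<ge> N * (- norm h)"
      using abs_apply_bcontfun_le_norm[of h k] N(1) by (intro mult_left_mono) auto
    moreover have "apply_bcontfun f k > 0" using inV[OF k] by (simp add: V_def)
    ultimately have "apply_bcontfun F k > - norm F" using nF by (simp add: F)
    then show ?thesis using k by (auto simp: norm_attainment_set_def)
  qed
  moreover have "F \<in> Y" unfolding F_def using f h Y(1) by (simp add: subspace_add subspace_scale)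
  ultimately show thesis
    using that[of F] inV \<open>norm F > 0\<close> by (auto simp: V_def)
qed

lemma one_signed_peak_not_orthogonal:
  fixes f g :: "'k::t2_space \<Rightarrow>\<^sub>C real"
  assumes f: "f \<in> C0" "f \<noteq> 0" and g: "g \<noteq> 0"
    and s: "\<bar>s\<bar> = 1" and e: "\<epsilon> < e" "e < 1"
    and sign: "\<And>k. k \<in> norm_attainment_set f \<Longrightarrow> apply_bcontfun f k = norm f"
    and large: "\<And>k. k \<in> norm_attainment_set f \<Longrightarrow> s * apply_bcontfun g k > e * norm g"
  shows "\<not> eps_BJ_orthogonal \<epsilon> f g"
proof
  assume orth: "eps_BJ_orthogonal \<epsilon> f g"
  define W where "W = {k. apply_bcontfun f k > 0} \<inter> {k. s * apply_bcontfun g k > e * norm g}"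
  have "open W"
    unfolding W_def
    by (intro open_Int open_Collect_less continuous_intros continuous_on_apply_bcontfun)
  moreover have "- W \<inter> norm_attainment_set f = {}"
    using sign large f(2) by (auto simp: W_def)
  ultimately obtain d where d: "d > 0" "d \<le> norm f"
    "\<And>k. k \<notin> W \<Longrightarrow> \<bar>apply_bcontfun f k\<bar> \<le> norm f - d"
    using C0_bounded_away_from_norm[OF f, of "- W"] by (metis Compl_iff closed_Compl)
  \<comment> \<open>So small that subtracting \<open>l * (s * g)\<close> uses at most half of the gap \<open>d\<close> off \<open>W\<close>.\<close>
  define l where "l = d / (2 * norm g)"
  have l: "l > 0" "l * norm g = d / 2" using d(1) g by (auto simp: l_def)
  have e': "l * (e * norm g) \<le> d / 2"
    using mult_left_mono[of e 1 "l * norm g"] e l d(1) by (simp add: algebra_simps)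
  have sg: "\<bar>l * (s * apply_bcontfun g k)\<bar> \<le> d / 2" for k
    using mult_left_mono[OF abs_apply_bcontfun_le_norm[of g k], of l] l s
    by (simp add: abs_mult)
  have "norm (f + (- l * s) *\<^sub>R g) \<le> norm f - l * (e * norm g)"
  proof (rule norm_bound)
    fix k
    have val: "apply_bcontfun (f + (- l * s) *\<^sub>R g) k
        = apply_bcontfun f k - l * (s * apply_bcontfun g k)"
      by simp
    show "norm (apply_bcontfun (f + (- l * s) *\<^sub>R g) k) \<le> norm f - l * (e * norm g)"
    proof (cases "k \<in> W")
      case True
      then have "l * (s * apply_bcontfun g k) \<ge> l * (e * norm g)" "apply_bcontfun f k > 0"
        using l(1) by (auto simp: W_def)
      then show ?thesis
        unfolding val real_norm_def
        using abs_apply_bcontfun_le_norm[of f k] sg[of k] e' d(2) by (simp only: abs_le_iff) linarith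
    next
      case False
      then show ?thesis
        unfolding val real_norm_def using d(3)[OF False] sg[of k] e' by linarith
    qed
  qed
  moreover have "norm f - \<epsilon> * norm ((- l * s) *\<^sub>R g) \<le> norm (f + (- l * s) *\<^sub>R g)"
    using orth unfolding eps_BJ_orthogonal_def by blast
  moreover have "norm ((- l * s) *\<^sub>R g) = l * norm g" using l(1) s by (simp add: abs_mult)
  then have "\<epsilon> * norm ((- l * s) *\<^sub>R g) = \<epsilon> * (l * norm g)" by (simp only:)
  ultimately have "l * (e * norm g) \<le> \<epsilon> * (l * norm g)" by linarith
  then have "l * norm g * e \<le> l * norm g * \<epsilon>" by (simp only: ac_simps)
  moreover have "l * norm g > 0" using l d(1) by simp
  ultimately show False using e(1) mult_le_cancel_left_pos by fastforce
qed

section \<open>Coapproximation and peaking functions\<close>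

lemma peaking_imp_strongly_anti_coproximinal:
  fixes Y :: "('k::t2_space \<Rightarrow>\<^sub>C real) set"
  assumes two: "\<exists>a b :: 'k. a \<noteq> b" and Y: "subspace Y" "Y \<subseteq> C0"
    and peak: "\<forall>U. open U \<and> U \<noteq> {} \<longrightarrow> (\<exists>f\<in>Y. norm_attainment_set f \<subseteq> U)"
  shows "strongly_anti_coproximinal C0 Y"
  unfolding strongly_anti_coproximinal_def
proof (intro ballI notI)
  fix x and \<epsilon> :: real
  assume x: "x \<in> C0 - Y" and \<epsilon>: "\<epsilon> \<in> {0..<1}" and "\<exists>y0. eps_best_coapproximation \<epsilon> Y x y0"
  then obtain y0 where y0: "y0 \<in> Y" "\<And>y. y \<in> Y \<Longrightarrow> eps_BJ_orthogonal \<epsilon> y (x - y0)"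
    unfolding eps_best_coapproximation_def by blast
  define g where "g = x - y0"
  have g: "g \<noteq> 0" using x y0(1) by (auto simp: g_def)
  obtain e where e: "\<epsilon> < e" "e < 1" using \<epsilon> dense by auto
  have "\<exists>k0. \<bar>apply_bcontfun g k0\<bar> > e * norm g"
  proof (rule ccontr)
    assume "\<not> ?thesis"
    then have "norm g \<le> e * norm g" by (intro norm_bound) (auto simp: not_less)
    then show False using e(2) g by simp
  qed
  then obtain k0 where k0: "\<bar>apply_bcontfun g k0\<bar> > e * norm g" ..
  define s :: real where "s = (if apply_bcontfun g k0 \<ge> 0 then 1 else -1)"
  have s: "\<bar>s\<bar> = 1" "s * apply_bcontfun g k0 > e * norm g"
    using k0 by (auto simp: s_def split: if_splits)
  obtain b where b: "b \<noteq> k0" using two by metis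
  \<comment> \<open>Removing \<open>b\<close> makes the open set proper, so that the function \<open>0\<close> does not peak in it.\<close>
  define U where "U = {k. s * apply_bcontfun g k > e * norm g} - {b}"
  have "open U"
    unfolding U_def
    by (intro open_Diff open_Collect_less continuous_intros continuous_on_apply_bcontfun)
  moreover have "U \<noteq> {}" "U \<noteq> UNIV" using s b by (auto simp: U_def)
  ultimately obtain F where F: "F \<in> Y" "F \<noteq> 0" "norm_attainment_set F \<subseteq> U"
    "\<forall>k \<in> norm_attainment_set F. apply_bcontfun F k = norm F"
    using ex_one_signed_peak[OF Y peak, of U] by metis
  have "\<not> eps_BJ_orthogonal \<epsilon> F g"
    using F Y(2) by (intro one_signed_peak_not_orthogonal[OF _ F(2) g s(1) e]) (auto simp: U_def)
  then show False using y0(2)[OF F(1)] by (simp add: g_def)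
qed

lemma best_coapproximation_imp_eps_best:
  assumes Y: "subspace Y" and best: "best_coapproximation Y x y0"
  shows "eps_best_coapproximation 0 Y x y0"
  unfolding eps_best_coapproximation_def eps_BJ_orthogonal_def
proof (intro conjI ballI allI)
  show y0: "y0 \<in> Y" using best by (simp add: best_coapproximation_def)
  fix y and c :: real
  assume y: "y \<in> Y"
  show "norm y - 0 * norm (c *\<^sub>R (x - y0)) \<le> norm (y + c *\<^sub>R (x - y0))"
  proof (cases "c = 0")
    case False
    \<comment> \<open>Compare the distances of \<open>y0\<close> and \<open>x\<close> from this element of \<open>Y\<close>, scaled by \<open>c\<close>.\<close>
    define z where "z = y0 - (1 / c) *\<^sub>R y"
    have "z \<in> Y" using y y0 Y by (simp add: z_def subspace_diff subspace_scale)
    then have "norm (y0 - z) \<le> norm (x - z)"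
      using best by (simp add: best_coapproximation_def)
    then have "norm (c *\<^sub>R (y0 - z)) \<le> norm (c *\<^sub>R (x - z))"
      by (simp add: mult_left_mono)
    moreover have "c *\<^sub>R (y0 - z) = y" "c *\<^sub>R (x - z) = y + c *\<^sub>R (x - y0)"
      using False by (simp_all add: z_def algebra_simps)
    ultimately show ?thesis by simp
  qed simp
qed

lemma strongly_anti_coproximinal_imp_anti_coproximinal:
  assumes "subspace Y" "strongly_anti_coproximinal X Y"
  shows "anti_coproximinal X Y"
  unfolding anti_coproximinal_def
proof (intro ballI notI)
  fix x
  assume "x \<in> X - Y" "\<exists>y0. best_coapproximation Y x y0"
  moreover have "(0::real) \<in> {0..<1}" by simp
  ultimately show False
    using best_coapproximation_imp_eps_best[OF assms(1)] assms(2)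
    unfolding strongly_anti_coproximinal_def by blast
qed

text \<open>A locally compact Hausdorff space is completely regular, which gives the function; local
  compactness also confines its support to a compact set, so that it lies in \<open>C\<^sub>0(K)\<close>.\<close>

lemma ex_C0_vanishing_outside_open:
  fixes U :: "'k::t2_space set"
  assumes lc: "locally_compact_space (euclidean :: 'k topology)" and U: "open U" "U \<noteq> {}"
  obtains x :: "'k \<Rightarrow>\<^sub>C real" where "x \<in> C0" "x \<noteq> 0" "\<And>k. k \<notin> U \<Longrightarrow> apply_bcontfun x k = 0"
proof -
  obtain p where p: "p \<in> U" using U by blast
  obtain V G where V: "open V" "compact G" "p \<in> V" "V \<subseteq> G"
    using lc unfolding locally_compact_space_def by (simp; metis)
  have "Hausdorff_space (euclidean :: 'k topology)"
    unfolding Hausdorff_space_def using hausdorff by (auto simp: disjnt_def)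
  then have "completely_regular_space (euclidean :: 'k topology)"
    using lc locally_compact_Hausdorff_imp_regular_space
      locally_compact_regular_imp_completely_regular_space by blast
  moreover have "closedin euclidean (- (U \<inter> V))" "p \<in> topspace euclidean - - (U \<inter> V)"
    using U V p by auto
  ultimately obtain u :: "'k \<Rightarrow> real" where u: "continuous_map euclidean (top_of_set {0..1}) u"
    "u p = 0" "u ` (- (U \<inter> V)) \<subseteq> {1}"
    unfolding completely_regular_space_def by blast
  have u01: "u k \<in> {0..1}" for k using u(1) by (auto simp: continuous_map_in_subtopology)
  have "continuous_on UNIV u" using u(1) by (simp add: continuous_map_in_subtopology)
  then have "continuous_on UNIV (\<lambda>k. 1 - u k)" by (intro continuous_intros)
  moreover have "norm (1 - u k) \<le> 1" for k using u01[of k] by auto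
  ultimately have "(\<lambda>k. 1 - u k) \<in> bcontfun" by (rule bcontfun_normI)
  then obtain x where x: "(\<lambda>k. 1 - u k) = apply_bcontfun x" by (rule bcontfunE)
  have out: "apply_bcontfun x k = 0" if "k \<notin> U \<inter> V" for k
    unfolding x[symmetric] using u(3) that by auto
  have "x \<in> C0"
    unfolding C0_def using V(2,4) out by force
  moreover have "apply_bcontfun x p = 1" unfolding x[symmetric] using u(2) by simp
  then have "x \<noteq> 0" by auto
  ultimately show thesis using that out by blast
qed

lemma anti_coproximinal_imp_peaking:
  fixes Y :: "('k::t2_space \<Rightarrow>\<^sub>C real) set"
  assumes lc: "locally_compact_space (euclidean :: 'k topology)" and "0 \<in> Y"
    and anti: "anti_coproximinal C0 Y" and U: "open U" "U \<noteq> {}"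
  shows "\<exists>f\<in>Y. norm_attainment_set f \<subseteq> U"
proof (rule ccontr)
  assume no: "\<not> ?thesis"
  obtain x :: "'k \<Rightarrow>\<^sub>C real"
    where x: "x \<in> C0" "x \<noteq> 0" "\<And>k. k \<notin> U \<Longrightarrow> apply_bcontfun x k = 0"
    using ex_C0_vanishing_outside_open[OF lc U] by metis
  have "norm_attainment_set x \<subseteq> U"
    using x by (force simp: norm_attainment_set_def)
  then have "x \<notin> Y" using no by blast
  moreover have "best_coapproximation Y x 0"
    unfolding best_coapproximation_def
  proof (intro conjI ballI)
    fix y assume "y \<in> Y"
    then obtain k where "k \<in> norm_attainment_set y" "k \<notin> U" using no by blast
    then have "norm y = \<bar>apply_bcontfun (x - y) k\<bar>"
      using x(3) by (simp add: norm_attainment_set_def)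
    then show "norm (0 - y) \<le> norm (x - y)"
      using abs_apply_bcontfun_le_norm[of "x - y" k] by simp
  qed fact
  ultimately show False using anti x(1) unfolding anti_coproximinal_def by blast
qed

theorem theorem3p30:
  fixes Y :: "('k::t2_space \<Rightarrow>\<^sub>C real) set"
  assumes "locally_connected_space (euclidean :: 'k topology)"
    and "locally_compact_space (euclidean :: 'k topology)"
    and "normal_space (euclidean :: 'k topology)"
    and "\<exists>a b :: 'k. a \<noteq> b"
    and "subspace Y" and "closedin (top_of_set C0) Y" and "Y \<subset> C0"
  shows "(strongly_anti_coproximinal C0 Y \<longleftrightarrow> anti_coproximinal C0 Y) \<and>
    (anti_coproximinal C0 Y \<longleftrightarrow>
      (\<forall>U. open U \<and> U \<noteq> {} \<longrightarrow> (\<exists>f\<in>Y. norm_attainment_set f \<subseteq> U)))"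
proof -
  have "strongly_anti_coproximinal C0 Y \<Longrightarrow> anti_coproximinal C0 Y"
    using assms(5) strongly_anti_coproximinal_imp_anti_coproximinal by blast
  moreover have "anti_coproximinal C0 Y \<Longrightarrow>
      \<forall>U. open U \<and> U \<noteq> {} \<longrightarrow> (\<exists>f\<in>Y. norm_attainment_set f \<subseteq> U)"
    using anti_coproximinal_imp_peaking[OF assms(2)] subspace_0[OF assms(5)] by blast
  moreover have "\<forall>U. open U \<and> U \<noteq> {} \<longrightarrow> (\<exists>f\<in>Y. norm_attainment_set f \<subseteq> U) \<Longrightarrow>
      strongly_anti_coproximinal C0 Y"
    using peaking_imp_strongly_anti_coproximinal[OF assms(4,5)] assms(7) by blast
  ultimately show ?thesis by blast
qed

end
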